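(* Let $b\in\mathscr{S}(n)$, $\alpha\in\mathcal{U}(n)$ and $\lambda\in\mathbb{T}$. If $b\alpha^*$ has a Carathéodory angular derivative at $\lambda$ on some subspace $E$ of $\mathbb{C}^n$, then for all $\mathbf{x}\in E$ the compressed function $P_E\,b\alpha^*|_E$ satisfies the Carathéodory condition at $\lambda$ in the codirection $\mathbf{x}$, that is, $$\liminf_{z\to\lambda\ \text{n.t.}}\frac{\|\mathbf{x}\|^2-\|P_E\,\alpha b(z)^*\mathbf{x}\|^2}{1-|z|^2}<\infty.$$
   Context: $\mathbb{D}$ is the open unit disc and $\mathbb{T}=\partial\mathbb{D}$. $\mathscr{S}(n)$ is the set of bounded analytic $n\times n$ matrix-valued functions $b$ on $\mathbb{D}$ with $\|b(z)\|<1$ (operator norm) for all $z\in\mathbb{D}$. $\mathcal{U}(n)$ is the group of unitary $n\times n$ matrices. $P_E$ is the orthogonal projection of $\mathbb{C}^n$ onto $E$. Non-tangential ("n.t.") approach $z\to\lambda$ means approach from within Stolz regions $\Gamma_t(\lambda)=\{z\in\mathbb{D}:|z-\lambda|<t(1-|z|)\}$, $t>1$; a non-tangential limit is a limit from within every such region. A function $f\in\mathscr{S}(n)$ has a Carathéodory angular derivative (CAD) at $\lambda\in\mathbb{T}$ on a subspace $E$ if $\lim_{z\to\lambda\ \text{n.t.}}f(z)\mathbf{e}=\mathbf{e}$ for every $\mathbf{e}\in E$, and the limit $\operatorname{CAD}_E f(\lambda):=\lim_{z\to\lambda\ \text{n.t.}}P_E\,f'(z)\,P_E$ exists. A strictly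 contractive analytic operator-valued function $f$ on $\mathbb{D}$ (acting on a finite-dimensional Hilbert space) satisfies the Carathéodory condition in the codirection $\mathbf{x}$ at $\lambda$ if $\liminf_{z\to\lambda\ \text{n.t.}}\dfrac{\|\mathbf{x}\|^2-\|f(z)^*\mathbf{x}\|^2}{1-|z|^2}<\infty$, i.e. there is a sequence $z_k\to\lambda$ contained in some Stolz region at $\lambda$ along which the quotient stays bounded. For $f=P_E\,b\alpha^*|_E$ acting on $E$, one has $f(z)^*=P_E\,\alpha b(z)^*|_E$. *)

theory Defs
  imports "HOL-Complex_Analysis.Complex_Analysis"
begin

text \<open>Complex linear algebra on \<open>complex ^ 'n\<close>. The library norm on this type is the
  Euclidean (Hermitian) norm, but its \<open>inner\<close> is only the real part of the Hermitian
  inner product, and the unqualified \<open>subspace\<close> means real subspace; complex subspaces are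
  \<open>vec.subspace\<close>.\<close>

definition cinner :: "complex ^ 'n \<Rightarrow> complex ^ 'n \<Rightarrow> complex" where
  "cinner x y = (\<Sum>i\<in>UNIV. x $ i * cnj (y $ i))"

definition cadjoint :: "complex ^ 'n ^ 'm \<Rightarrow> complex ^ 'm ^ 'n" where
  "cadjoint A = (\<chi> i j. cnj (A $ j $ i))"

definition unitary_group :: "(complex ^ 'n ^ 'n) set" where
  "unitary_group = {U. cadjoint U ** U = mat 1 \<and> U ** cadjoint U = mat 1}"

text \<open>Matrix of the orthogonal projection onto \<open>E\<close>; meaningful when \<open>vec.subspace E\<close>.\<close>

definition orth_proj :: "(complex ^ 'n) set \<Rightarrow> complex ^ 'n ^ 'n" where
  "orth_proj E = (THE P. \<forall>x. P *v x \<in> E \<and> (\<forall>e\<in>E. cinner (x - P *v x) e = 0))"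

definition schur_class :: "(complex \<Rightarrow> complex ^ 'n ^ 'n) set" where
  "schur_class = {b. (\<forall>i j. (\<lambda>z. b z $ i $ j) holomorphic_on ball 0 1) \<and>
     bounded (b ` ball 0 1) \<and>
     (\<forall>z\<in>ball 0 1. onorm (\<lambda>x. b z *v x) < 1)}"

definition matrix_deriv :: "(complex \<Rightarrow> complex ^ 'n ^ 'm) \<Rightarrow> complex \<Rightarrow> complex ^ 'n ^ 'm" where
  "matrix_deriv f z = (\<chi> i j. deriv (\<lambda>w. f w $ i $ j) z)"

definition stolz :: "real \<Rightarrow> complex \<Rightarrow> complex set" where
  "stolz t l = {z \<in> ball 0 1. norm (z - l) < t * (1 - norm z)}"

definition nt_tendsto :: "(complex \<Rightarrow> 'a::topological_space) \<Rightarrow> 'a \<Rightarrow> complex \<Rightarrow> bool" where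
  "nt_tendsto f L l \<longleftrightarrow> (\<forall>t>1. (f \<longlongrightarrow> L) (at l within stolz t l))"

text \<open>Stolz regions grow with the aperture, so the lower limit over all non-tangential
  approaches is the infimum of the lower limits over the individual regions. In particular
  it is less than \<open>\<infinity>\<close> iff some sequence in some Stolz region converges to \<open>l\<close> and keeps
  \<open>q\<close> bounded above.\<close>

definition nt_liminf :: "(complex \<Rightarrow> real) \<Rightarrow> complex \<Rightarrow> ereal" where
  "nt_liminf q l = (INF t\<in>{1<..}. Liminf (at l within stolz t l) (\<lambda>z. ereal (q z)))"

definition has_CAD_on ::
  "(complex \<Rightarrow> complex ^ 'n ^ 'n) \<Rightarrow> complex \<Rightarrow> (complex ^ 'n) set \<Rightarrow> bool" where
  "has_CAD_on f l E \<longleftrightarrow> f \<in> schur_class \<and>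
     (\<forall>e\<in>E. nt_tendsto (\<lambda>z. f z *v e) e l) \<and>
     (\<exists>L. nt_tendsto (\<lambda>z. orth_proj E ** matrix_deriv f z ** orth_proj E) L l)"

text \<open>An operator on the Hilbert space \<open>E\<close> is represented by a function on the ambient
  space of which only the values on \<open>E\<close> matter; its adjoint is taken within \<open>E\<close>.\<close>

definition compression ::
  "(complex ^ 'n) set \<Rightarrow> complex ^ 'n ^ 'n \<Rightarrow> complex ^ 'n \<Rightarrow> complex ^ 'n" where
  "compression E A x = orth_proj E *v (A *v x)"

definition adjoint_on ::
  "(complex ^ 'n) set \<Rightarrow> (complex ^ 'n \<Rightarrow> complex ^ 'n) \<Rightarrow> complex ^ 'n \<Rightarrow> complex ^ 'n" where
  "adjoint_on E T x = (THE y. y \<in> E \<and> (\<forall>u\<in>E. cinner (T u) x = cinner u y))"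

definition caratheodory_condition ::
  "(complex ^ 'n) set \<Rightarrow> (complex \<Rightarrow> complex ^ 'n \<Rightarrow> complex ^ 'n) \<Rightarrow> complex ^ 'n \<Rightarrow> complex \<Rightarrow> bool"
  where
  "caratheodory_condition E f x l \<longleftrightarrow>
     nt_liminf (\<lambda>z. ((norm x)\<^sup>2 - (norm (adjoint_on E (f z) x))\<^sup>2) / (1 - (norm z)\<^sup>2)) l < \<infinity>"

end

theory Submission
  imports Defs
begin

text \<open>Write \<open>f = b \<alpha>\<^sup>*\<close> and, for \<open>x \<in> E\<close>, \<open>G z = \<langle>f z x, x\<rangle>\<close>. The angular derivative makes
  \<open>G' z = \<langle>P f' z P x, x\<rangle>\<close> bounded near \<open>l\<close> inside a Stolz region; Stolz regions are convex, so
  the mean value inequality gives \<open>\<bar>\<parallel>x\<parallel>\<^sup>2 - G z\<bar> = O(\<bar>l - z\<bar>) = O(1 - \<bar>z\<bar>)\<close> there. Finally, with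
  \<open>y = P f(z)\<^sup>* x\<close>, expanding \<open>\<parallel>x - y\<parallel>\<^sup>2 \<ge> 0\<close> yields
  \<open>\<parallel>x\<parallel>\<^sup>2 - \<parallel>y\<parallel>\<^sup>2 \<le> 2 Re (\<parallel>x\<parallel>\<^sup>2 - G z)\<close>.\<close>

section \<open>Hermitian form and adjoint matrices\<close>

lemma Re_cinner: "Re (cinner x y) = x \<bullet> y"
  by (simp add: cinner_def inner_vec_def inner_complex_def)

lemma cinner_commute: "cinner y x = cnj (cinner x y)"
  by (simp add: cinner_def mult.commute)

lemma cinner_self: "cinner x x = of_real ((norm x)\<^sup>2)"
proof (rule complex_eqI)
  show "Re (cinner x x) = Re (of_real ((norm x)\<^sup>2))"
    by (simp only: Re_cinner power2_norm_eq_inner Re_complex_of_real)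
  show "Im (cinner x x) = Im (of_real ((norm x)\<^sup>2))"
    using arg_cong[OF cinner_commute[of x x], of Im] by simp
qed

lemma cinner_diff_left: "cinner (x - y) z = cinner x z - cinner y z"
  by (simp add: cinner_def left_diff_distrib sum_subtractf)

lemma cinner_diff_right: "cinner z (x - y) = cinner z x - cinner z y"
  by (simp add: cinner_def right_diff_distrib sum_subtractf)

lemma cinner_add_left: "cinner (x + y) z = cinner x z + cinner y z"
  by (simp add: cinner_def distrib_right sum.distrib)

lemma cinner_scale_left: "cinner (c *s x) y = c * cinner x y"
  by (simp add: cinner_def sum_distrib_left mult.assoc)

lemma cinner_scale_right: "cinner x (c *s y) = cnj c * cinner x y"
  by (simp add: cinner_def sum_distrib_left mult.left_commute)

lemma cinner_cadjoint: "cinner (A *v x) y = cinner x (cadjoint A *v y)"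
proof -
  have "cinner (A *v x) y = (\<Sum>i\<in>UNIV. \<Sum>j\<in>UNIV. A $ i $ j * x $ j * cnj (y $ i))"
    by (simp add: cinner_def matrix_vector_mult_def sum_distrib_right)
  also have "\<dots> = (\<Sum>j\<in>UNIV. \<Sum>i\<in>UNIV. A $ i $ j * x $ j * cnj (y $ i))"
    by (rule sum.swap)
  also have "\<dots> = cinner x (cadjoint A *v y)"
    by (simp add: cinner_def matrix_vector_mult_def cadjoint_def sum_distrib_left ac_simps)
  finally show ?thesis .
qed

lemma cadjoint_mult: "cadjoint (A ** B) = cadjoint B ** cadjoint A"
  by (simp add: vec_eq_iff cadjoint_def matrix_matrix_mult_def mult.commute)

lemma cadjoint_cadjoint: "cadjoint (cadjoint A) = A"
  by (simp add: vec_eq_iff cadjoint_def)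

section \<open>Orthogonal projection onto a complex subspace, and adjoints within it\<close>

lemma vec_subspace_imp_subspace:
  assumes "vec.subspace (E :: (complex ^ 'n) set)"
  shows "subspace E"
proof (rule subspaceI)
  show "c *\<^sub>R x \<in> E" if "x \<in> E" for c x
  proof -
    have "c *\<^sub>R x = complex_of_real c *s x"
      by (simp add: vec_eq_iff scaleR_conv_of_real[where 'a = complex])
    then show ?thesis using vec.subspace_scale[OF assms that] by simp
  qed
qed (use assms in \<open>auto intro: vec.subspace_0 vec.subspace_add\<close>)

text \<open>The real orthogonal decomposition already works: \<open>E\<close> is closed under
  multiplication by the imaginary unit, so real orthogonality to all of \<open>E\<close> forces
  Hermitian orthogonality.\<close>

lemma orthogonal_decomposition:
  assumes E: "vec.subspace (E :: (complex ^ 'n) set)"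
  obtains y where "y \<in> E" "\<And>e. e \<in> E \<Longrightarrow> cinner (x - y) e = 0"
proof -
  obtain y z where yz: "y \<in> span E" "\<And>w. w \<in> span E \<Longrightarrow> orthogonal z w" "x = y + z"
    using orthogonal_subspace_decomp_exists[of E x] by metis
  have "span E = E"
    using vec_subspace_imp_subspace[OF E] by (simp add: span_eq_iff)
  with yz have "y \<in> E" and z: "z \<bullet> e = 0" if "e \<in> E" for e
    using that by (auto simp: orthogonal_def)
  have "cinner z e = 0" if "e \<in> E" for e
  proof (rule complex_eqI)
    show "Re (cinner z e) = Re 0" using z[OF that] by (simp add: Re_cinner)
    \<comment> \<open>Conjugate linearity in the second argument turns this real part into the
      imaginary part of \<open>cinner z e\<close>.\<close>
    have "Re (cinner z (\<i> *s e)) = 0"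
      using z[OF vec.subspace_scale[OF E that]] by (simp add: Re_cinner)
    then show "Im (cinner z e) = Im 0" by (simp add: cinner_scale_right)
  qed
  with yz \<open>span E = E\<close> show thesis by (intro that[of y]) auto
qed

lemma orthogonal_decomposition_unique:
  assumes E: "vec.subspace (E :: (complex ^ 'n) set)"
    and "y \<in> E" "y' \<in> E"
    and "\<And>e. e \<in> E \<Longrightarrow> cinner (x - y) e = 0" "\<And>e. e \<in> E \<Longrightarrow> cinner (x - y') e = 0"
  shows "y = y'"
proof -
  have "y - y' \<in> E" using assms by (intro vec.subspace_diff) auto
  then have "cinner (x - y) (y - y') = 0" "cinner (x - y') (y - y') = 0"
    using assms by blast+
  then have "cinner (y - y') (y - y') = 0" by (simp add: cinner_diff_left)
  then show ?thesis by (simp add: cinner_self)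
qed

text \<open>Justifies the definite description in \<open>orth_proj\<close>: a pointwise choice of
  projections is linear by uniqueness of the decomposition, hence given by a matrix, and the same
  uniqueness identifies any other candidate with it.\<close>

lemma orth_proj:
  assumes E: "vec.subspace (E :: (complex ^ 'n) set)"
  shows orth_proj_in: "orth_proj E *v x \<in> E"
    and orth_proj_orthogonal: "e \<in> E \<Longrightarrow> cinner (x - orth_proj E *v x) e = 0"
proof -
  have "\<exists>y. y \<in> E \<and> (\<forall>e\<in>E. cinner (x - y) e = 0)" for x
    by (rule orthogonal_decomposition[OF E, of x]) blast
  then obtain p where p: "\<And>x. p x \<in> E" "\<And>x e. e \<in> E \<Longrightarrow> cinner (x - p x) e = 0"
    by metis
  have "Vector_Spaces.linear (*s) (*s) p"
    unfolding Vector_Spaces.linear_iff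
  proof (intro conjI allI vec.vector_space_axioms)
    fix x y :: "complex ^ 'n" and c :: complex
    show "p (x + y) = p x + p y"
    proof (rule orthogonal_decomposition_unique[OF E])
      fix e assume "e \<in> E"
      then have "cinner (x - p x) e = 0" "cinner (y - p y) e = 0" using p by auto
      then show "cinner (x + y - (p x + p y)) e = 0"
        by (simp add: cinner_diff_left cinner_add_left)
    qed (use p E in \<open>auto intro: vec.subspace_add\<close>)
    show "p (c *s x) = c *s p x"
    proof (rule orthogonal_decomposition_unique[OF E])
      fix e assume "e \<in> E"
      then have "c * cinner (x - p x) e = 0" using p by simp
      then show "cinner (c *s x - c *s p x) e = 0"
        by (simp add: cinner_diff_left cinner_scale_left right_diff_distrib)
    qed (use p E in \<open>auto intro: vec.subspace_scale\<close>)
  qed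
  then have P: "matrix p *v x = p x" for x by (rule matrix_works)
  have "orth_proj E = matrix p"
    unfolding orth_proj_def
  proof (rule the_equality)
    show "\<forall>x. matrix p *v x \<in> E \<and> (\<forall>e\<in>E. cinner (x - matrix p *v x) e = 0)"
      using p by (simp add: P)
    fix Q assume "\<forall>x. Q *v x \<in> E \<and> (\<forall>e\<in>E. cinner (x - Q *v x) e = 0)"
    then have "Q *v x = matrix p *v x" for x
      unfolding P using p by (intro orthogonal_decomposition_unique[OF E]) auto
    then show "Q = matrix p" by (simp add: matrix_eq)
  qed
  then show "orth_proj E *v x \<in> E" "e \<in> E \<Longrightarrow> cinner (x - orth_proj E *v x) e = 0"
    using p by (simp_all add: P)
qed

lemma orth_proj_id:
  assumes "vec.subspace E" "x \<in> E"
  shows "orth_proj E *v x = x"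
  by (rule orthogonal_decomposition_unique[OF assms(1), where x = x])
    (use assms in \<open>simp_all add: orth_proj_in orth_proj_orthogonal, simp add: cinner_def\<close>)

lemma cinner_orth_proj_left:
  assumes "vec.subspace E" "x \<in> E"
  shows "cinner (orth_proj E *v y) x = cinner y x"
  using orth_proj_orthogonal[OF assms, of y] by (simp add: cinner_diff_left)

lemma cinner_orth_proj_right:
  assumes "vec.subspace E" "x \<in> E"
  shows "cinner x (orth_proj E *v y) = cinner x y"
  by (metis assms cinner_commute cinner_orth_proj_left)

lemma adjoint_on_compression:
  assumes E: "vec.subspace E" and x: "x \<in> E"
  shows "adjoint_on E (compression E A) x = orth_proj E *v (cadjoint A *v x)"
  unfolding adjoint_on_def
proof (rule the_equality)
  show *: "orth_proj E *v (cadjoint A *v x) \<in> E \<and>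
      (\<forall>u\<in>E. cinner (compression E A u) x = cinner u (orth_proj E *v (cadjoint A *v x)))"
    using E x by (simp add: compression_def orth_proj_in cinner_orth_proj_left
        cinner_orth_proj_right flip: cinner_cadjoint)
  fix y assume y: "y \<in> E \<and> (\<forall>u\<in>E. cinner (compression E A u) x = cinner u y)"
  \<comment> \<open>Two candidates pair equally with every element of \<open>E\<close>, in
    particular with their own difference.\<close>
  let ?d = "y - orth_proj E *v (cadjoint A *v x)"
  have "?d \<in> E" using * y E by (intro vec.subspace_diff) auto
  with * y have "cinner ?d ?d = 0" by (simp add: cinner_diff_right)
  then show "y = orth_proj E *v (cadjoint A *v x)" by (simp add: cinner_self)
qed

section \<open>Stolz regions and estimates along them\<close>

lemma convex_stolz:
  assumes "t \<ge> 0"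
  shows "convex (stolz t l)"
proof -
  \<comment> \<open>Moving \<open>t * norm z\<close> to the left exhibits the region as the disc cut
    with a strict sublevel set of a convex function.\<close>
  have "convex_on UNIV (\<lambda>z. norm (z - l))"
    using convex_on_dist[of UNIV l] convex_UNIV by (simp add: dist_norm norm_minus_commute)
  moreover have "convex_on UNIV (\<lambda>z::complex. norm z)"
    using convex_on_dist[of UNIV 0] convex_UNIV by simp
  ultimately have cvx: "convex_on UNIV (\<lambda>z. norm (z - l) + t * norm z)" (is "convex_on _ ?h")
    using assms by (intro convex_on_add convex_on_cmul)
  have "convex {z. ?h z < t}"
  proof (rule convexI)
    fix x y and u v :: real
    assume uv: "x \<in> {z. ?h z < t}" "y \<in> {z. ?h z < t}" "0 \<le> u" "0 \<le> v" "u + v = 1"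
    then have "?h (u *\<^sub>R x + v *\<^sub>R y) \<le> u * ?h x + v * ?h y"
      using cvx unfolding convex_on_def by blast
    also have "\<dots> < t" using uv by (intro convex_bound_lt) auto
    finally show "u *\<^sub>R x + v *\<^sub>R y \<in> {z. ?h z < t}" by simp
  qed
  moreover have "stolz t l = ball 0 1 \<inter> {z. norm (z - l) + t * norm z < t}"
    by (auto simp: stolz_def algebra_simps)
  ultimately show ?thesis by (simp add: convex_Int)
qed

text \<open>The radius ending at \<open>l\<close> stays in the region, because there the distance to
  \<open>l\<close> equals \<open>1 - norm z\<close> and \<open>t > 1\<close>. Nontriviality of the
  filter is what lets limits preserve inequalities later.\<close>

lemma at_within_stolz_neq_bot:
  assumes l: "norm l = 1" and t: "t > 1"
  shows "at l within stolz t l \<noteq> bot"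
proof -
  have "l islimpt stolz t l"
    unfolding islimpt_approachable
  proof (intro allI impI)
    fix e :: real assume "e > 0"
    \<comment> \<open>The bound \<open>1/2\<close> keeps the radial point off the origin side of the
      disc, and \<open>e/2\<close> puts it within \<open>e\<close> of \<open>l\<close>.\<close>
    define s where "s = min (1/2) (e/2)"
    have s: "0 < s" "s < 1" "s < e" using \<open>e > 0\<close> by (auto simp: s_def)
    define z where "z = of_real (1 - s) * l"
    have "norm z = 1 - s"
      unfolding z_def norm_mult norm_of_real using s l by simp
    moreover have "norm (z - l) = s"
      using s l by (simp add: z_def norm_mult left_diff_distrib)
    moreover have "s < t * s" using s t by simp
    ultimately have "z \<in> stolz t l" "z \<noteq> l" "dist z l < e"
      using s by (auto simp: stolz_def dist_norm)
    then show "\<exists>z\<in>stolz t l. z \<noteq> l \<and> dist z l < e" by blast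
  qed
  then show ?thesis by (simp add: trivial_limit_within)
qed

text \<open>A bound for one aperture suffices, since \<open>nt_liminf\<close> is an infimum over
  apertures.\<close>

lemma nt_liminf_less_infinity:
  assumes "norm l = 1" "t > 1" and bd: "\<forall>\<^sub>F z in at l within stolz t l. q z \<le> C"
  shows "nt_liminf q l < \<infinity>"
proof -
  let ?F = "at l within stolz t l"
  have "nt_liminf q l \<le> Liminf ?F (\<lambda>z. ereal (q z))"
    unfolding nt_liminf_def using \<open>t > 1\<close> by (intro INF_lower) simp
  also have "\<dots> \<le> Limsup ?F (\<lambda>z. ereal (q z))"
    using at_within_stolz_neq_bot assms by (intro Liminf_le_Limsup) auto
  also have "\<dots> \<le> ereal C"
    using bd by (intro Limsup_bounded) simp
  finally show ?thesis by (auto simp: le_less_trans)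
qed

text \<open>The mean value inequality up to the boundary point: it is applied between two points of
  the region, and then one of them tends to \<open>l\<close>.\<close>

lemma stolz_linear_approach:
  fixes G :: "complex \<Rightarrow> complex"
  assumes l: "norm l = 1" and t: "t > 1"
    and deriv: "\<And>z. z \<in> ball 0 1 \<Longrightarrow> (G has_field_derivative G' z) (at z)"
    and G: "(G \<longlongrightarrow> a) (at l within stolz t l)"
    and G': "(G' \<longlongrightarrow> c) (at l within stolz t l)"
  obtains C where "C \<ge> 0" "\<forall>\<^sub>F z in at l within stolz t l. norm (a - G z) \<le> C * norm (l - z)"
proof -
  let ?F = "at l within stolz t l"
  \<comment> \<open>The extra 1 makes the strict bound on \<open>G'\<close> hold near
    \<open>l\<close>.\<close>
  define C where "C = norm c + 1"
  have "\<forall>\<^sub>F z in ?F. norm (G' z) < C"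
    using order_tendstoD(2)[OF tendsto_norm[OF G'], of C] by (simp add: C_def)
  then obtain d where d: "d > 0" "\<And>z. \<lbrakk>z \<in> stolz t l; z \<noteq> l; dist z l < d\<rbrakk> \<Longrightarrow> norm (G' z) < C"
    by (auto simp: eventually_at)
  define S where "S = ball l d \<inter> stolz t l"
  have "convex S" using t by (simp add: S_def convex_Int convex_stolz)
  have lS: "z \<in> ball 0 1" "z \<noteq> l" if "z \<in> S" for z
    using that l by (auto simp: S_def stolz_def)
  have lip: "norm (G w - G z) \<le> C * norm (w - z)" if "z \<in> S" "w \<in> S" for w z
  proof (rule field_differentiable_bound[OF \<open>convex S\<close>])
    show "(G has_field_derivative G' u) (at u within S)" if "u \<in> S" for u
      using deriv[OF lS(1)[OF that]] by (rule has_field_derivative_at_within)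
    show "norm (G' u) \<le> C" if "u \<in> S" for u
      using d(2)[of u] lS(2)[OF that] that by (auto simp: S_def dist_commute)
  qed (use that in auto)
  have evS: "\<forall>\<^sub>F z in ?F. z \<in> S"
    using \<open>d > 0\<close> by (auto simp: eventually_at S_def dist_commute)
  \<comment> \<open>With \<open>z\<close> fixed, let \<open>w\<close> tend to \<open>l\<close> in
    \<open>lip\<close>.\<close>
  have "norm (a - G z) \<le> C * norm (l - z)" if "z \<in> S" for z
  proof (rule tendsto_le[OF at_within_stolz_neq_bot[OF l t]])
    show "((\<lambda>w. norm (G w - G z)) \<longlongrightarrow> norm (a - G z)) ?F" by (intro tendsto_intros G)
    show "((\<lambda>w. C * norm (w - z)) \<longlongrightarrow> C * norm (l - z)) ?F" by (intro tendsto_intros)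
    show "\<forall>\<^sub>F w in ?F. norm (G w - G z) \<le> C * norm (w - z)"
      using evS by eventually_elim (rule lip[OF that])
  qed
  with evS have "\<forall>\<^sub>F z in ?F. norm (a - G z) \<le> C * norm (l - z)"
    by (rule eventually_mono)
  then show thesis by (intro that[of C]) (auto simp: C_def)
qed

section \<open>From the angular derivative to the bounded quotient\<close>

lemma has_field_derivative_cinner_matrix:
  fixes f :: "complex \<Rightarrow> complex ^ 'n ^ 'm"
  assumes "\<And>i j. (\<lambda>z. f z $ i $ j) holomorphic_on S" "open S" "z \<in> S"
  shows "((\<lambda>z. cinner (f z *v x) y) has_field_derivative cinner (matrix_deriv f z *v x) y) (at z)"
proof -
  have "((\<lambda>z. f z $ i $ j) has_field_derivative matrix_deriv f z $ i $ j) (at z)" for i j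
    using holomorphic_derivI[OF assms(1,2,3), of i j] by (simp add: matrix_deriv_def)
  then show ?thesis
    unfolding cinner_def matrix_vector_mult_def
    by (auto intro!: DERIV_sum DERIV_cmult_right)
qed

lemma has_CAD_on_bounded_quotient:
  assumes l: "norm l = 1" and E: "vec.subspace E" and cad: "has_CAD_on f l E" and x: "x \<in> E"
    and t: "t > 1"
  obtains C where "\<forall>\<^sub>F z in at l within stolz t l.
    ((norm x)\<^sup>2 - (norm (orth_proj E *v (cadjoint (f z) *v x)))\<^sup>2) / (1 - (norm z)\<^sup>2) \<le> C"
proof -
  let ?F = "at l within stolz t l"
  let ?P = "orth_proj E"
  define G where "G = (\<lambda>z. cinner (f z *v x) x)"
  define G' where "G' = (\<lambda>z. cinner (matrix_deriv f z *v x) x)"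
  have deriv: "(G has_field_derivative G' z) (at z)" if "z \<in> ball 0 1" for z
    unfolding G_def G'_def using cad that
    by (intro has_field_derivative_cinner_matrix[of f "ball 0 1"])
      (auto simp: has_CAD_on_def schur_class_def)
  have "((\<lambda>z. f z *v x) \<longlongrightarrow> x) ?F"
    using cad x t by (auto simp: has_CAD_on_def nt_tendsto_def)
  then have G: "(G \<longlongrightarrow> cinner x x) ?F"
    unfolding G_def cinner_def by (intro tendsto_intros)
  obtain L where L: "((\<lambda>z. ?P ** matrix_deriv f z ** ?P) \<longlongrightarrow> L) ?F"
    using cad t by (auto simp: has_CAD_on_def nt_tendsto_def)
  have "((\<lambda>z. cinner ((?P ** matrix_deriv f z ** ?P) *v x) x) \<longlongrightarrow> cinner (L *v x) x) ?F"
    unfolding cinner_def matrix_vector_mult_def vec_lambda_beta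
    by (intro tendsto_intros tendsto_vec_nth L)
  \<comment> \<open>The right projection fixes \<open>x\<close>, and the left one is absorbed by
    pairing with \<open>x\<close>, so the limit of the compressed derivative controls
    \<open>G'\<close>.\<close>
  moreover have "cinner ((?P ** matrix_deriv f z ** ?P) *v x) x = G' z" for z
    by (simp add: G'_def orth_proj_id[OF E x] cinner_orth_proj_left[OF E x]
        flip: matrix_vector_mul_assoc)
  ultimately have G': "(G' \<longlongrightarrow> cinner (L *v x) x) ?F" by simp
  obtain C where "C \<ge> 0" and C: "\<forall>\<^sub>F z in ?F. norm (cinner x x - G z) \<le> C * norm (l - z)"
    using stolz_linear_approach[OF l t deriv G G'] by blast
  have "\<forall>\<^sub>F z in ?F. z \<in> stolz t l" by (auto simp: eventually_at_filter)
  \<comment> \<open>In \<open>2 * C * t\<close>, the factor 2 comes from expanding the square,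
    \<open>C\<close> from the mean value estimate, and \<open>t\<close> from the Stolz
    inequality.\<close>
  with C have "\<forall>\<^sub>F z in ?F.
    ((norm x)\<^sup>2 - (norm (?P *v (cadjoint (f z) *v x)))\<^sup>2) / (1 - (norm z)\<^sup>2) \<le> 2 * C * t"
  proof eventually_elim
    case (elim z)
    define y where "y = ?P *v (cadjoint (f z) *v x)"
    have z: "norm z < 1" "norm (l - z) \<le> t * (1 - norm z)"
      using elim(2) by (auto simp: stolz_def norm_minus_commute)
    have "Re (G z) = x \<bullet> y"
      by (simp add: G_def y_def cinner_cadjoint cinner_orth_proj_right[OF E x] flip: Re_cinner)
    then have "x \<bullet> x - x \<bullet> y = Re (cinner x x - G z)" by (simp add: Re_cinner)
    also have "\<dots> \<le> C * norm (l - z)"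
      using elim(1) complex_Re_le_cmod by (rule order_trans[rotated])
    also have "\<dots> \<le> C * (t * (1 - norm z))"
      using z(2) \<open>C \<ge> 0\<close> by (rule mult_left_mono)
    finally have 1: "x \<bullet> x - x \<bullet> y \<le> C * t * (1 - norm z)" by simp
    have "0 \<le> (x - y) \<bullet> (x - y)" by simp
    also have "\<dots> = x \<bullet> x - 2 * (x \<bullet> y) + y \<bullet> y"
      by (simp add: inner_diff inner_commute)
    finally have "(norm x)\<^sup>2 - (norm y)\<^sup>2 \<le> 2 * C * t * (1 - norm z)"
      using 1 by (simp add: power2_norm_eq_inner)
    \<comment> \<open>In the disc \<open>(norm z)\<^sup>2\<close> is at most
      \<open>norm z\<close>.\<close>
    also have "\<dots> \<le> 2 * C * t * (1 - (norm z)\<^sup>2)"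
      using z(1) \<open>C \<ge> 0\<close> t power_decreasing[of 1 2 "norm z"] by (intro mult_left_mono) auto
    finally have "(norm x)\<^sup>2 - (norm y)\<^sup>2 \<le> 2 * C * t * (1 - (norm z)\<^sup>2)" .
    moreover have "0 < 1 - (norm z)\<^sup>2"
      using z(1) by (simp add: power_less_one_iff)
    ultimately show ?case
      by (simp add: y_def pos_divide_le_eq)
  qed
  then show thesis by (rule that)
qed

theorem theorem8p2:
  fixes b :: "complex \<Rightarrow> complex ^ 'n ^ 'n"
    and \<alpha> :: "complex ^ 'n ^ 'n"
    and l :: complex
    and E :: "(complex ^ 'n) set"
  assumes "b \<in> schur_class"
    and "\<alpha> \<in> unitary_group"
    and "l \<in> sphere 0 1"
    and "vec.subspace E"
    and "has_CAD_on (\<lambda>z. b z ** cadjoint \<alpha>) l E"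
  shows "\<forall>x\<in>E.
    caratheodory_condition E (\<lambda>z. compression E (b z ** cadjoint \<alpha>)) x l \<and>
    nt_liminf (\<lambda>z. ((norm x)\<^sup>2 - (norm (orth_proj E *v (\<alpha> *v (cadjoint (b z) *v x))))\<^sup>2)
      / (1 - (norm z)\<^sup>2)) l < \<infinity>"
proof
  fix x assume x: "x \<in> E"
  have l: "norm l = 1" using assms(3) by simp
  \<comment> \<open>This identity makes the two conjuncts of the goal statements about the same
    quotient.\<close>
  have adj: "cadjoint (b z ** cadjoint \<alpha>) *v x = \<alpha> *v (cadjoint (b z) *v x)" for z
    by (simp add: cadjoint_mult cadjoint_cadjoint matrix_vector_mul_assoc)
  \<comment> \<open>The aperture 2 is an arbitrary choice above 1.\<close>
  obtain C where "\<forall>\<^sub>F z in at l within stolz 2 l.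
    ((norm x)\<^sup>2 - (norm (orth_proj E *v (\<alpha> *v (cadjoint (b z) *v x))))\<^sup>2) / (1 - (norm z)\<^sup>2) \<le> C"
    using has_CAD_on_bounded_quotient[OF l assms(4,5) x, of 2] by (auto simp: adj)
  then have "nt_liminf (\<lambda>z. ((norm x)\<^sup>2 - (norm (orth_proj E *v (\<alpha> *v (cadjoint (b z) *v x))))\<^sup>2)
      / (1 - (norm z)\<^sup>2)) l < \<infinity>"
    by (intro nt_liminf_less_infinity[OF l, of 2]) auto
  then show "caratheodory_condition E (\<lambda>z. compression E (b z ** cadjoint \<alpha>)) x l \<and>
    nt_liminf (\<lambda>z. ((norm x)\<^sup>2 - (norm (orth_proj E *v (\<alpha> *v (cadjoint (b z) *v x))))\<^sup>2)
      / (1 - (norm z)\<^sup>2)) l < \<infinity>"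
    by (simp add: caratheodory_condition_def adjoint_on_compression[OF assms(4) x] adj)
qed

end
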